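(* Let $(p_n)$ be a sequence with $p_n\in(0,\tfrac12]$ and let $f_n:\{0,1\}^n\to\{0,1\}$ be a weakly global sequence of Boolean functions (with respect to $\mu_{p_n}$). Then $(f_n)$ is noise sensitive: for every fixed $\rho\in(0,1)$, $\mathrm{Stab}_\rho(f_n) = \mu_{p_n}(f_n)^2 + o(\mu_{p_n}(f_n))$ as $n\to\infty$.
   Context: $\mu_p$ is the $p$-biased product measure on $\{0,1\}^n$. For $x\in\{0,1\}^n$, $\mathbf{y}\sim N_\rho(x)$ is obtained by independently setting $\mathbf{y}_i=x_i$ with probability $\rho$ and otherwise resampling $\mathbf{y}_i$ with $\Pr[\mathbf{y}_i=1]=p$; $\mathrm{T}_\rho f(x)=\mathbb{E}_{\mathbf{y}\sim N_\rho(x)}[f(\mathbf{y})]$ and $\mathrm{Stab}_\rho(f)=\mathbb{E}_{\mathbf{x}\sim\mu_p}[f(\mathbf{x})\mathrm{T}_\rho f(\mathbf{x})]$ (all with $p=p_n$). For $J\subseteq[n]$, $f_{J\to1}$ is the restriction setting coordinates of $J$ to $1$. The sequence $(f_n)$ is sparse if $\mu_{p_n}(f_n)=o(1)$, and weakly global if it is sparse and for every $\varepsilon,C>0$ there is $n_0$ such that $\mu_{p_n}((f_n)_{J\to1})<\varepsilon$ for all $n>n_0$ and all $J\subseteq[n]$ with $|J|\le C$. *)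

theory Defs
  imports "HOL-Probability.Probability" "HOL-Library.Landau_Symbols"
begin

(* A point of {0,1}^S is a function nat => bool that is False outside S (True plays the role
   of 1), matching the default value used by Pi_pmf below. *)

definition cube :: "nat set \<Rightarrow> (nat \<Rightarrow> bool) set" where
  "cube S = PiE_dflt S False (\<lambda>_. UNIV)"

(* bernoulli_pmf clamps its parameter to [0,1]; all uses below have parameters in that range. *)

definition biased :: "real \<Rightarrow> nat set \<Rightarrow> (nat \<Rightarrow> bool) pmf" where
  "biased p S = Pi_pmf S False (\<lambda>_. bernoulli_pmf p)"

definition mu :: "real \<Rightarrow> nat set \<Rightarrow> ((nat \<Rightarrow> bool) \<Rightarrow> real) \<Rightarrow> real" where
  "mu p S f = measure_pmf.expectation (biased p S) f"

definition noise :: "real \<Rightarrow> nat set \<Rightarrow> real \<Rightarrow> (nat \<Rightarrow> bool) \<Rightarrow> (nat \<Rightarrow> bool) pmf" where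
  "noise p S \<rho> x = Pi_pmf S False
     (\<lambda>i. bind_pmf (bernoulli_pmf \<rho>) (\<lambda>keep. if keep then return_pmf (x i) else bernoulli_pmf p))"

definition noise_op ::
  "real \<Rightarrow> nat set \<Rightarrow> real \<Rightarrow> ((nat \<Rightarrow> bool) \<Rightarrow> real) \<Rightarrow> (nat \<Rightarrow> bool) \<Rightarrow> real" where
  "noise_op p S \<rho> f x = measure_pmf.expectation (noise p S \<rho> x) f"

definition stab :: "real \<Rightarrow> nat set \<Rightarrow> real \<Rightarrow> ((nat \<Rightarrow> bool) \<Rightarrow> real) \<Rightarrow> real" where
  "stab p S \<rho> f = measure_pmf.expectation (biased p S) (\<lambda>x. f x * noise_op p S \<rho> f x)"

(* For f on {0,1}^S and J a subset of S, the restriction is a function on {0,1}^(S - J); its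
   measure is accordingly taken with respect to the biased measure on S - J. *)

definition restrict1 :: "nat set \<Rightarrow> ((nat \<Rightarrow> bool) \<Rightarrow> real) \<Rightarrow> (nat \<Rightarrow> bool) \<Rightarrow> real" where
  "restrict1 J f x = f (\<lambda>i. if i \<in> J then True else x i)"

definition sparse :: "(nat \<Rightarrow> real) \<Rightarrow> (nat \<Rightarrow> (nat \<Rightarrow> bool) \<Rightarrow> real) \<Rightarrow> bool" where
  "sparse p f \<longleftrightarrow> (\<lambda>n. mu (p n) {1..n} (f n)) \<longlonglongrightarrow> 0"

definition weakly_global :: "(nat \<Rightarrow> real) \<Rightarrow> (nat \<Rightarrow> (nat \<Rightarrow> bool) \<Rightarrow> real) \<Rightarrow> bool" where
  "weakly_global p f \<longleftrightarrow> sparse p f \<and>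
     (\<forall>\<epsilon>>0. \<forall>C::real. C > 0 \<longrightarrow>
        (\<exists>n0. \<forall>n>n0. \<forall>J\<subseteq>{1..n}. real (card J) \<le> C \<longrightarrow>
           mu (p n) ({1..n} - J) (restrict1 J (f n)) < \<epsilon>))"

definition noise_sensitive :: "(nat \<Rightarrow> real) \<Rightarrow> (nat \<Rightarrow> (nat \<Rightarrow> bool) \<Rightarrow> real) \<Rightarrow> bool" where
  "noise_sensitive p f \<longleftrightarrow>
     (\<forall>\<rho>\<in>{0<..<1}.
        (\<lambda>n. stab (p n) {1..n} \<rho> (f n) - (mu (p n) {1..n} (f n))\<^sup>2)
          \<in> o(\<lambda>n. mu (p n) {1..n} (f n)))"

end

theory Submission
  imports Defs
begin

text \<open>The stability is \<open>\<Sum>\<^sub>T \<rho>^|T| a(T)\<^sup>2\<close> in terms of the \<open>p\<close>-biased Fourier coefficients \<open>a\<close>, and \<open>a({})\<close> is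
  the mean, so it suffices to show that the weight \<open>W\<close> of \<open>f\<close> on levels up to a fixed \<open>d\<close> is
  \<open>o(\<mu>(f))\<close>. Let \<open>g\<close> be the part of \<open>f\<close> of degree at most \<open>d\<close>. Then \<open>W = E[f g]\<close>, and since \<open>f\<close> is
  \<open>0/1\<close>-valued, \<open>f g \<le> (3/4) s f + g^4 / (4 s^3)\<close> pointwise for every \<open>s > 0\<close>. A hypercontractive
  inequality bounds \<open>E[g^4]\<close> by a constant power \<open>C^d\<close> times \<open>W\<close> times the largest squared norm of a
  discrete derivative of \<open>f\<close> of order at most \<open>d\<close>. As \<open>p \<le> 1/2\<close>, setting coordinates to \<open>0\<close> at most
  doubles the measure per coordinate, so these norms are small as soon as the restrictions
  \<open>f\<^bsub>J\<rightarrow>1\<^esub>\<close> with \<open>|J| \<le> d\<close> have small measure.\<close>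

section \<open>Power-set sums and expectations over product measures on the cube\<close>

lemma sum_Pow_insert:
  fixes g :: "'a set \<Rightarrow> 'b::comm_monoid_add"
  assumes "finite S" "i \<notin> S"
  shows "(\<Sum>T\<in>Pow (insert i S). g T) = (\<Sum>T\<in>Pow S. g T) + (\<Sum>T\<in>Pow S. g (insert i T))"
proof -
  have "inj_on (insert i) (Pow S)"
    using assms(2) by (auto simp: inj_on_def)
  then have "sum g (insert i ` Pow S) = (\<Sum>T\<in>Pow S. g (insert i T))"
    by (simp add: sum.reindex)
  then show ?thesis
    unfolding Pow_insert using assms by (subst sum.union_disjoint) auto
qed

lemma finite_set_Pi_pmf:
  fixes q :: "'a \<Rightarrow> bool pmf"
  shows "finite S \<Longrightarrow> finite (set_pmf (Pi_pmf S False q))"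
  by (auto simp: set_Pi_pmf)

lemma set_Pi_pmf_subset_cube: "finite S \<Longrightarrow> set_pmf (Pi_pmf S False q) \<subseteq> cube S"
  by (auto simp: set_Pi_pmf cube_def PiE_dflt_def)

text \<open>Conditioning on coordinate \<open>i\<close> gives the recursion for \<open>mu\<close>
  and \<open>noise_op\<close> that drives the inductions over the dimension.\<close>

lemma expectation_Pi_pmf_insert:
  fixes q :: "'a \<Rightarrow> bool pmf" and f :: "('a \<Rightarrow> bool) \<Rightarrow> real"
  assumes "finite S" "i \<notin> S"
  shows "measure_pmf.expectation (Pi_pmf (insert i S) False q) f =
    measure_pmf.expectation (Pi_pmf S False q)
      (\<lambda>x. pmf (q i) True * f (x(i := True)) + pmf (q i) False * f (x(i := False)))"
proof -
  have int: "integrable (Pi_pmf S False q) g" for g :: "('a \<Rightarrow> bool) \<Rightarrow> real"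
    using assms(1) by (intro integrable_measure_pmf_finite finite_set_Pi_pmf)
  have "measure_pmf.expectation (Pi_pmf (insert i S) False q) f =
    (\<Sum>b\<in>UNIV. pmf (q i) b *\<^sub>R measure_pmf.expectation (map_pmf (\<lambda>x. x(i := b)) (Pi_pmf S False q)) f)"
    unfolding Pi_pmf_insert'[OF assms] map_pmf_def[symmetric]
    using assms(1) by (intro pmf_expectation_bind) (auto simp: finite_set_Pi_pmf)
  then show ?thesis
    by (simp add: UNIV_bool int)
qed

text \<open>The product measure is supported in \<open>cube S\<close>. Comparing only there matters
  because a function agrees with its Fourier expansion only on the cube.\<close>

lemma expectation_mono_cube:
  assumes "finite S" "\<And>x. x \<in> cube S \<Longrightarrow> f x \<le> g x"
  shows "measure_pmf.expectation (Pi_pmf S False q) f \<le> (measure_pmf.expectation (Pi_pmf S False q) g :: real)"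
  using assms set_Pi_pmf_subset_cube[of S q]
  by (intro integral_mono_AE integrable_measure_pmf_finite finite_set_Pi_pmf)
     (auto simp: AE_measure_pmf_iff)

lemma mu_mono:
  "finite S \<Longrightarrow> (\<And>x. x \<in> cube S \<Longrightarrow> f x \<le> g x) \<Longrightarrow> mu p S f \<le> mu p S g"
  unfolding mu_def biased_def by (rule expectation_mono_cube)

lemma mu_cong:
  "finite S \<Longrightarrow> (\<And>x. x \<in> cube S \<Longrightarrow> f x = g x) \<Longrightarrow> mu p S f = mu p S g"
  by (intro antisym mu_mono) auto

lemma noise_op_cong:
  "finite S \<Longrightarrow> (\<And>x. x \<in> cube S \<Longrightarrow> f x = g x) \<Longrightarrow> noise_op p S \<rho> f x = noise_op p S \<rho> g x"
  unfolding noise_op_def noise_def by (intro antisym expectation_mono_cube) auto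

lemma stab_eq_mu: "stab p S \<rho> f = mu p S (\<lambda>x. f x * noise_op p S \<rho> f x)"
  by (simp add: stab_def mu_def)

lemma mu_add: "finite S \<Longrightarrow> mu p S (\<lambda>x. f x + g x) = mu p S f + mu p S g"
  unfolding mu_def biased_def
  by (intro Bochner_Integration.integral_add integrable_measure_pmf_finite finite_set_Pi_pmf)

lemma mu_cmult: "mu p S (\<lambda>x. c * f x) = c * mu p S f"
  by (simp add: mu_def)

lemma mu_nonneg: "finite S \<Longrightarrow> (\<And>x. x \<in> cube S \<Longrightarrow> 0 \<le> f x) \<Longrightarrow> 0 \<le> mu p S f"
  using mu_mono[of S "\<lambda>_. 0" f p] by (simp add: mu_def)

lemma noise_op_add:
  "finite S \<Longrightarrow> noise_op p S \<rho> (\<lambda>x. f x + g x) x = noise_op p S \<rho> f x + noise_op p S \<rho> g x"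
  unfolding noise_op_def noise_def
  by (intro Bochner_Integration.integral_add integrable_measure_pmf_finite finite_set_Pi_pmf)

lemma noise_op_cmult: "noise_op p S \<rho> (\<lambda>x. c * f x) x = c * noise_op p S \<rho> f x"
  by (simp add: noise_op_def)

lemma mu_empty: "mu p {} f = f (\<lambda>_. False)"
  by (simp add: mu_def biased_def)

lemma noise_op_empty: "noise_op p {} \<rho> f x = f (\<lambda>_. False)"
  by (simp add: noise_op_def noise_def)

section \<open>Squared coefficients above a given set\<close>

text \<open>If \<open>a\<close> is the family of Fourier coefficients of \<open>f\<close> and \<open>\<sigma>\<^sup>2 = p (1 - p)\<close>, then
  \<open>upper_weight a S R / \<sigma>^(2|R|)\<close> is the squared \<open>L\<^sup>2\<close>-norm of the discrete derivative of \<open>f\<close> in the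
  directions \<open>R\<close> (for \<open>R \<subseteq> S\<close>).\<close>

definition upper_weight :: "('a set \<Rightarrow> real) \<Rightarrow> 'a set \<Rightarrow> 'a set \<Rightarrow> real" where
  "upper_weight a S R = (\<Sum>T\<in>Pow (S - R). (a (R \<union> T))\<^sup>2)"

lemma upper_weight_nonneg: "0 \<le> upper_weight a S R"
  by (auto simp: upper_weight_def intro: sum_nonneg)

lemma upper_weight_insert:
  assumes "finite S" "i \<notin> S" "R \<subseteq> S"
  shows "upper_weight a (insert i S) R = upper_weight a S R + upper_weight (\<lambda>T. a (insert i T)) S R"
    and "upper_weight a (insert i S) (insert i R) = upper_weight (\<lambda>T. a (insert i T)) S R"
proof -
  have "i \<notin> R" using assms by auto
  then have 1: "insert i S - R = insert i (S - R)" by auto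
  show "upper_weight a (insert i S) R = upper_weight a S R + upper_weight (\<lambda>T. a (insert i T)) S R"
    unfolding upper_weight_def 1 using assms by (subst sum_Pow_insert) auto
  have 2: "insert i S - insert i R = S - R" using assms by auto
  show "upper_weight a (insert i S) (insert i R) = upper_weight (\<lambda>T. a (insert i T)) S R"
    unfolding upper_weight_def 2 by simp
qed

text \<open>Double counting: each \<open>T\<close> is counted once for every \<open>R\<close>
  contained in it, that is, \<open>2 ^ card T\<close> times.\<close>

lemma sum_upper_weight:
  assumes "finite S"
  shows "(\<Sum>R\<in>Pow S. upper_weight a S R) = (\<Sum>T\<in>Pow S. 2 ^ card T * (a T)\<^sup>2)"
  using assms
proof (induction S arbitrary: a)
  case empty
  then show ?case by (simp add: upper_weight_def)
next
  case (insert i S)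
  let ?a = "\<lambda>T. a (insert i T)"
  have "(\<Sum>R\<in>Pow (insert i S). upper_weight a (insert i S) R) =
    (\<Sum>R\<in>Pow S. upper_weight a S R) + 2 * (\<Sum>R\<in>Pow S. upper_weight ?a S R)"
    using insert.hyps by (simp add: sum_Pow_insert upper_weight_insert sum.distrib)
  also have "\<dots> = (\<Sum>T\<in>Pow S. 2 ^ card T * (a T)\<^sup>2) + (\<Sum>T\<in>Pow S. 2 ^ card (insert i T) * (?a T)\<^sup>2)"
  proof -
    have "card (insert i T) = Suc (card T)" if "T \<in> Pow S" for T
      using that insert.hyps by (intro card_insert_disjoint) (auto intro: finite_subset)
    then show ?thesis
      by (simp add: insert.IH sum_distrib_left mult.assoc)
  qed
  also have "\<dots> = (\<Sum>T\<in>Pow (insert i S). 2 ^ card T * (a T)\<^sup>2)"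
    using insert.hyps by (simp add: sum_Pow_insert)
  finally show ?case .
qed

section \<open>Biased Fourier analysis\<close>

locale biased_cube =
  fixes p :: real
  assumes p_pos: "0 < p" and p_le: "p \<le> 1 / 2"
begin

definition sd :: real where "sd = sqrt (p * (1 - p))"

definition chi :: "bool \<Rightarrow> real" where "chi b = (of_bool b - p) / sd"

text \<open>Coefficients are an arbitrary family on all sets, not only on subsets of
  \<open>S\<close>, so that the shifted family \<open>\<lambda>T. a (insert i T)\<close> can be used
  directly in inductions.\<close>

definition fourier :: "(nat set \<Rightarrow> real) \<Rightarrow> nat set \<Rightarrow> (nat \<Rightarrow> bool) \<Rightarrow> real" where
  "fourier a S x = (\<Sum>T\<in>Pow S. a T * (\<Prod>i\<in>T. chi (x i)))"

lemma sd_pos: "0 < sd"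
  using p_pos p_le by (simp add: sd_def)

lemma sd_sq: "sd\<^sup>2 = p * (1 - p)"
  using p_pos p_le by (simp add: sd_def)

lemma chi_simps: "chi True = (1 - p) / sd" "chi False = - p / sd"
  by (simp_all add: chi_def)

lemma chi_diff: "chi True - chi False = 1 / sd"
  using sd_pos by (simp add: chi_simps field_simps)

lemma chi_mean: "p * chi True + (1 - p) * chi False = 0"
  by (simp add: chi_simps field_simps)

lemma chi_var: "p * (chi True)\<^sup>2 + (1 - p) * (chi False)\<^sup>2 = 1"
proof -
  have "p * (chi True)\<^sup>2 + (1 - p) * (chi False)\<^sup>2 = (p * (1 - p)) / sd\<^sup>2"
    by (simp add: chi_simps power_divide add_divide_distrib[symmetric]) (simp add: algebra_simps power2_eq_square)
  also have "\<dots> = 1"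
    using sd_pos by (simp flip: sd_sq)
  finally show ?thesis .
qed

text \<open>The third moment is exactly \<open>(1 - 2 * p) / sd\<close>. It is bounded in squared
  form because it enters \<open>two_point_inequality\<close> through AM-GM.\<close>

lemma chi_third: "(p * chi True ^ 3 + (1 - p) * chi False ^ 3)\<^sup>2 \<le> 1 / sd\<^sup>2"
proof -
  have "p * chi True ^ 3 + (1 - p) * chi False ^ 3 = (p * (1 - p)) * (1 - 2 * p) / sd ^ 3"
    by (simp add: chi_simps power_divide add_divide_distrib[symmetric])
       (simp add: diff_divide_distrib[symmetric], simp add: algebra_simps power2_eq_square power3_eq_cube)
  also have "\<dots> = (1 - 2 * p) / sd"
    unfolding sd_sq[symmetric] using sd_pos by (simp add: field_simps power2_eq_square power3_eq_cube)
  finally have "(p * chi True ^ 3 + (1 - p) * chi False ^ 3)\<^sup>2 = (1 - 2 * p)\<^sup>2 / sd\<^sup>2"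
    by (simp add: power_divide)
  moreover have "(1 - 2 * p)\<^sup>2 \<le> 1"
    using p_pos p_le by (intro power_le_one) auto
  ultimately show ?thesis
    by (simp add: divide_right_mono)
qed

lemma chi_fourth: "p * chi True ^ 4 + (1 - p) * chi False ^ 4 \<le> 1 / sd\<^sup>2"
proof -
  have "p * chi True ^ 4 + (1 - p) * chi False ^ 4 = (p * (1 - p)) * (1 - 3 * (p * (1 - p))) / sd ^ 4"
    by (simp add: chi_simps power_divide add_divide_distrib[symmetric])
       (simp add: algebra_simps eval_nat_numeral)
  also have "\<dots> = (1 - 3 * (p * (1 - p))) / sd\<^sup>2"
    unfolding sd_sq[symmetric] using sd_pos by (simp add: field_simps eval_nat_numeral)
  also have "\<dots> \<le> 1 / sd\<^sup>2"
    using p_pos p_le by (intro divide_right_mono) auto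
  finally show ?thesis .
qed

lemma mu_insert:
  assumes "finite S" "i \<notin> S"
  shows "mu p (insert i S) f = mu p S (\<lambda>x. p * f (x(i := True)) + (1 - p) * f (x(i := False)))"
  using p_pos p_le unfolding mu_def biased_def
  by (subst expectation_Pi_pmf_insert[OF assms]) simp

lemma noise_op_insert:
  assumes "finite S" "i \<notin> S" "0 \<le> \<rho>" "\<rho> \<le> 1"
  defines "r \<equiv> \<lambda>x. \<rho> * of_bool (x i) + (1 - \<rho>) * p"
  shows "noise_op p (insert i S) \<rho> f x =
    noise_op p S \<rho> (\<lambda>y. r x * f (y(i := True)) + (1 - r x) * f (y(i := False))) x"
proof -
  let ?q = "bind_pmf (bernoulli_pmf \<rho>) (\<lambda>keep. if keep then return_pmf (x i) else bernoulli_pmf p)"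
  have "pmf ?q True = r x" "pmf ?q False = 1 - r x"
    using assms(3,4) p_pos p_le by (auto simp: pmf_bind r_def indicator_def algebra_simps)
  then show ?thesis
    unfolding noise_op_def noise_def by (subst expectation_Pi_pmf_insert[OF assms(1,2)]) simp
qed

lemma fourier_empty: "fourier a {} x = a {}"
  by (simp add: fourier_def)

text \<open>Splits by whether \<open>T\<close> contains \<open>i\<close>. By
  \<open>chi_diff\<close>, the second summand's family expands \<open>sd\<close> times the discrete
  derivative in direction \<open>i\<close>.\<close>

lemma fourier_insert:
  assumes "finite S" "i \<notin> S"
  shows "fourier a (insert i S) (x(i := b)) =
    fourier a S x + chi b * fourier (\<lambda>T. a (insert i T)) S x"
proof -
  have upd: "(\<Prod>j\<in>T. chi ((x(i := b)) j)) = (\<Prod>j\<in>T. chi (x j))" if "T \<in> Pow S" for T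
    using that assms(2) by (intro prod.cong) auto
  have ins: "(\<Prod>j\<in>insert i T. chi ((x(i := b)) j)) = chi b * (\<Prod>j\<in>T. chi (x j))" if "T \<in> Pow S" for T
    using that assms upd[OF that] by (subst prod.insert) (auto intro: finite_subset)
  have "fourier a (insert i S) (x(i := b)) =
    (\<Sum>T\<in>Pow S. a T * (\<Prod>j\<in>T. chi ((x(i := b)) j))) +
    (\<Sum>T\<in>Pow S. a (insert i T) * (\<Prod>j\<in>insert i T. chi ((x(i := b)) j)))"
    unfolding fourier_def by (rule sum_Pow_insert[OF assms])
  also have "\<dots> = fourier a S x + chi b * fourier (\<lambda>T. a (insert i T)) S x"
    unfolding fourier_def sum_distrib_left
    by (intro arg_cong2[where f = "(+)"] sum.cong) (simp_all only: upd ins mult_ac)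
  finally show ?thesis .
qed

lemma fourier_cong: "(\<And>T. T \<subseteq> S \<Longrightarrow> a T = b T) \<Longrightarrow> fourier a S x = fourier b S x"
  by (simp add: fourier_def)

lemma fourier_cmult: "fourier (\<lambda>T. c * a T) S x = c * fourier a S x"
  by (simp add: fourier_def sum_distrib_left mult.assoc)

lemma fourier_add: "fourier (\<lambda>T. a T + b T) S x = fourier a S x + fourier b S x"
  by (simp add: fourier_def distrib_right sum.distrib)

text \<open>Fixing a coordinate is absorbed into the coefficients, so a restriction is again a
  Fourier expansion.\<close>

lemma fourier_insert':
  assumes "finite S" "i \<notin> S"
  shows "fourier a (insert i S) (x(i := b)) = fourier (\<lambda>T. a T + chi b * a (insert i T)) S x"
  by (simp only: fourier_insert[OF assms] fourier_add fourier_cmult)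

lemma fourier_scale_insert:
  assumes "finite S" "i \<notin> S"
  shows "fourier (\<lambda>T. c ^ card T * a T) (insert i S) (x(i := b)) =
    fourier (\<lambda>T. c ^ card T * a T) S x +
    c * chi b * fourier (\<lambda>T. c ^ card T * a (insert i T)) S x"
proof -
  have "fourier (\<lambda>T. c ^ card (insert i T) * a (insert i T)) S x =
    fourier (\<lambda>T. c * (c ^ card T * a (insert i T))) S x"
  proof (rule fourier_cong)
    fix T assume "T \<subseteq> S"
    then have "card (insert i T) = Suc (card T)"
      using assms by (intro card_insert_disjoint) (auto intro: finite_subset)
    then show "c ^ card (insert i T) * a (insert i T) = c * (c ^ card T * a (insert i T))"
      by simp
  qed
  then show ?thesis
    by (simp add: fourier_insert[OF assms] fourier_cmult)
qed

lemma fourier_exists: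
  assumes "finite S"
  shows "\<exists>a. \<forall>x\<in>cube S. f x = fourier a S x"
  using assms
proof (induction S arbitrary: f)
  case empty
  have "cube {} = {\<lambda>_. False}" by (auto simp: cube_def PiE_dflt_def)
  then show ?case by (auto simp: fourier_empty intro!: exI[of _ "\<lambda>_. f (\<lambda>_. False)"])
next
  case (insert i S)
  obtain a1 where a1: "\<And>x. x \<in> cube S \<Longrightarrow> f (x(i := True)) = fourier a1 S x"
    using insert.IH[of "\<lambda>x. f (x(i := True))"] by auto
  obtain a0 where a0: "\<And>x. x \<in> cube S \<Longrightarrow> f (x(i := False)) = fourier a0 S x"
    using insert.IH[of "\<lambda>x. f (x(i := False))"] by auto
  \<comment> \<open>For \<open>T\<close> without \<open>i\<close>, the pair \<open>a T\<close>,
    \<open>a (insert i T)\<close> solves the two linear equations that the restrictions to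
    \<open>True\<close> and \<open>False\<close> impose.\<close>
  define a where "a T = (if i \<in> T then sd * (a1 (T - {i}) - a0 (T - {i}))
    else p * a1 T + (1 - p) * a0 T)" for T
  have chi: "sd * chi True = 1 - p" "sd * chi False = - p"
    using sd_pos by (simp_all add: chi_simps)
  have a: "a T + chi b * a (insert i T) = (if b then a1 T else a0 T)" if "T \<subseteq> S" for T b
  proof -
    have "i \<notin> T" using that insert.hyps by auto
    then have "a T + chi b * a (insert i T) =
      p * a1 T + (1 - p) * a0 T + (sd * chi b) * (a1 T - a0 T)"
      by (simp add: a_def)
    also have "\<dots> = (if b then a1 T else a0 T)"
      by (cases b) (simp_all only: chi, simp_all add: algebra_simps)
    finally show ?thesis .
  qed
  have "f x = fourier a (insert i S) x" if x: "x \<in> cube (insert i S)" for x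
  proof -
    define y where "y = x(i := False)"
    have y: "y \<in> cube S" using x by (auto simp: y_def cube_def PiE_dflt_def)
    have xy: "x = y(i := x i)" by (simp add: y_def)
    have "fourier a (insert i S) (y(i := x i)) = fourier (if x i then a1 else a0) S y"
      unfolding fourier_insert'[OF insert.hyps] using a by (intro fourier_cong) auto
    also have "\<dots> = f (y(i := x i))"
      using a1[OF y] a0[OF y] by (cases "x i") auto
    finally show ?thesis using xy by metis
  qed
  then show ?case by blast
qed

text \<open>Peeling off \<open>i\<close>, the cross terms vanish because \<open>chi\<close> has mean
  0, and the product of the shifted parts keeps weight 1 because \<open>chi\<close> has variance
  1.\<close>

lemma parseval:
  assumes "finite S"
  shows "mu p S (\<lambda>x. fourier a S x * fourier b S x) = (\<Sum>T\<in>Pow S. a T * b T)"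
  using assms
proof (induction S arbitrary: a b)
  case empty
  then show ?case by (simp add: mu_empty fourier_empty)
next
  case (insert i S)
  let ?a = "\<lambda>T. a (insert i T)" and ?b = "\<lambda>T. b (insert i T)"
  have *: "p * ((u + chi True * u') * (v + chi True * v')) + (1 - p) * ((u + chi False * u') * (v + chi False * v'))
      = u * v + u' * v'" for u u' v v'
  proof -
    have "p * ((u + chi True * u') * (v + chi True * v')) + (1 - p) * ((u + chi False * u') * (v + chi False * v'))
      = u * v + (p * chi True + (1 - p) * chi False) * (u * v' + u' * v)
        + (p * (chi True)\<^sup>2 + (1 - p) * (chi False)\<^sup>2) * (u' * v')"
      by algebra
    then show ?thesis by (simp only: chi_mean chi_var)
  qed
  have "mu p (insert i S) (\<lambda>x. fourier a (insert i S) x * fourier b (insert i S) x) =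
    mu p S (\<lambda>x. fourier a S x * fourier b S x + fourier ?a S x * fourier ?b S x)"
    by (simp only: mu_insert[OF insert.hyps] fourier_insert[OF insert.hyps] *)
  also have "\<dots> = (\<Sum>T\<in>Pow (insert i S). a T * b T)"
    using insert.hyps by (simp add: mu_add insert.IH sum_Pow_insert)
  finally show ?case .
qed

text \<open>The mean is the inner product with the constant 1, whose only nonzero coefficient sits
  at \<open>{}\<close>.\<close>

lemma mu_fourier:
  assumes "finite S"
  shows "mu p S (fourier a S) = a {}"
proof -
  have "fourier (\<lambda>T. of_bool (T = {})) S x = (\<Sum>T\<in>Pow S. if T = {} then 1 else 0)" for x
    unfolding fourier_def by (intro sum.cong) auto
  then have "fourier (\<lambda>T. of_bool (T = {})) S x = 1" for x
    using assms by simp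
  then have "mu p S (fourier a S) = mu p S (\<lambda>x. fourier a S x * fourier (\<lambda>T. of_bool (T = {})) S x)"
    by simp
  also have "\<dots> = a {}"
    using assms by (simp add: parseval)
  finally show ?thesis .
qed

text \<open>A resampled coordinate has \<open>chi\<close>-mean 0 and a kept one has value
  \<open>chi (x i)\<close>, so every coordinate in \<open>T\<close> contributes a factor
  \<open>\<rho>\<close>. In the proof, \<open>r\<close> is the probability that the noisy coordinate
  \<open>i\<close> is \<open>True\<close>.\<close>

lemma noise_op_fourier:
  assumes "finite S" "0 \<le> \<rho>" "\<rho> \<le> 1"
  shows "noise_op p S \<rho> (fourier a S) x = fourier (\<lambda>T. \<rho> ^ card T * a T) S x"
  using assms(1)
proof (induction S arbitrary: a)
  case empty
  then show ?case by (simp add: noise_op_empty fourier_empty)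
next
  case (insert i S)
  let ?a = "\<lambda>T. a (insert i T)"
  define r where "r = \<rho> * of_bool (x i) + (1 - \<rho>) * p"
  have r: "r * chi True + (1 - r) * chi False = \<rho> * chi (x i)"
  proof -
    have "r * chi True + (1 - r) * chi False = (r - p) * (chi True - chi False)
      + (p * chi True + (1 - p) * chi False)" by algebra
    also have "\<dots> = \<rho> * chi (x i)"
      unfolding chi_mean chi_diff by (cases "x i") (simp_all add: r_def chi_def algebra_simps diff_divide_distrib)
    finally show ?thesis .
  qed
  have *: "r * (u + chi True * v) + (1 - r) * (u + chi False * v) = u + (\<rho> * chi (x i)) * v" for u v
    unfolding r[symmetric] by algebra
  have "noise_op p (insert i S) \<rho> (fourier a (insert i S)) x =
    noise_op p S \<rho> (\<lambda>y. fourier a S y + (\<rho> * chi (x i)) * fourier ?a S y) x"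
    by (simp only: noise_op_insert[OF insert.hyps assms(2,3)] fourier_insert[OF insert.hyps] r_def[symmetric] *)
  also have "\<dots> = fourier (\<lambda>T. \<rho> ^ card T * a T) S x
    + \<rho> * chi (x i) * fourier (\<lambda>T. \<rho> ^ card T * a (insert i T)) S x"
    by (simp only: noise_op_add[OF insert.hyps(1)] noise_op_cmult insert.IH)
  also have "\<dots> = fourier (\<lambda>T. \<rho> ^ card T * a T) (insert i S) (x(i := x i))"
    by (simp only: fourier_scale_insert[OF insert.hyps])
  finally show ?case by simp
qed

lemma stab_fourier:
  assumes "finite S" "0 \<le> \<rho>" "\<rho> \<le> 1" "\<And>x. x \<in> cube S \<Longrightarrow> f x = fourier a S x"
  shows "stab p S \<rho> f = (\<Sum>T\<in>Pow S. \<rho> ^ card T * (a T)\<^sup>2)"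
proof -
  have "stab p S \<rho> f = mu p S (\<lambda>x. fourier a S x * fourier (\<lambda>T. \<rho> ^ card T * a T) S x)"
    unfolding stab_eq_mu using assms
    by (intro mu_cong) (simp_all add: noise_op_cong[of S f "fourier a S"] noise_op_fourier)
  then show ?thesis
    by (simp add: parseval assms(1) power2_eq_square mult_ac)
qed

section \<open>Hypercontractivity\<close>

text \<open>Expand in powers of \<open>chi\<close>: the first moment vanishes, the second is 1, and
  the noise factor 1/2 shrinks the higher terms enough for AM-GM to absorb the mixed products
  \<open>Q\<close>, \<open>U\<close> and \<open>V\<close>.\<close>

lemma two_point_inequality:
  "p * ((g + 1 / 2 * chi True * g')\<^sup>2 * (h + 1 / 2 * chi True * h')\<^sup>2)
    + (1 - p) * ((g + 1 / 2 * chi False * g')\<^sup>2 * (h + 1 / 2 * chi False * h')\<^sup>2)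
   \<le> g\<^sup>2 * h\<^sup>2 + g\<^sup>2 * h'\<^sup>2 + g'\<^sup>2 * h\<^sup>2 + (1 / sd\<^sup>2) * (g'\<^sup>2 * h'\<^sup>2)"
  (is "?L \<le> ?R")
proof -
  define m where "m k = p * chi True ^ k + (1 - p) * chi False ^ k" for k
  define X where "X = g\<^sup>2 * h'\<^sup>2"
  define Y where "Y = g'\<^sup>2 * h\<^sup>2"
  define Z where "Z = g'\<^sup>2 * h'\<^sup>2"
  define Q where "Q = g * g' * h * h'"
  define U where "U = m 3 * (g * g' * h'\<^sup>2)"
  define A where "A = (m 3)\<^sup>2 * Z"
  define B where "B = m 4 * Z"
  define K where "K = (1 / sd\<^sup>2) * Z"
  define V where "V = m 3 * (g'\<^sup>2 * h * h')"
  have m1: "m 1 = 0" using chi_mean by (simp add: m_def)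
  have m2: "m 2 = 1" using chi_var by (simp add: m_def)
  have "?L = g\<^sup>2 * h\<^sup>2 + m 1 * (g\<^sup>2 * h * h' + g * g' * h\<^sup>2)
      + m 2 * ((X + Y) / 4 + Q) + U / 4 + V / 4 + m 4 * Z / 16"
    unfolding m_def X_def Y_def Z_def Q_def U_def V_def by (simp add: field_simps eval_nat_numeral)
  then have expand: "?L = g\<^sup>2 * h\<^sup>2 + (X + Y) / 4 + Q + U / 4 + V / 4 + B / 16"
    unfolding m1 m2 B_def by simp
  have "2 * Q \<le> X + Y"
    using sum_squares_bound[of "g * h'" "g' * h"]
    by (simp add: X_def Y_def Q_def power_mult_distrib mult_ac)
  moreover have "2 * U \<le> X + A"
    using sum_squares_bound[of "g * h'" "m 3 * (g' * h')"]
    by (simp add: X_def Z_def A_def U_def power_mult_distrib algebra_simps power2_eq_square)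
  moreover have "2 * V \<le> Y + A"
    using sum_squares_bound[of "g' * h" "m 3 * (g' * h')"]
    by (simp add: Y_def Z_def A_def V_def power_mult_distrib algebra_simps power2_eq_square)
  moreover have "0 \<le> X" "0 \<le> Y" "0 \<le> Z" by (simp_all add: X_def Y_def Z_def)
  moreover from \<open>0 \<le> Z\<close> have "A \<le> K" "B \<le> K" "0 \<le> K"
    using mult_right_mono[OF chi_third, of Z] mult_right_mono[OF chi_fourth, of Z] by (simp_all add: m_def A_def B_def K_def)
  \<comment> \<open>The bounds add up to coefficient 7/8 for \<open>X\<close> and for
    \<open>Y\<close>, and 5/16 for \<open>K\<close>.\<close>
  ultimately have "(X + Y) / 4 + Q + U / 4 + V / 4 + B / 16 \<le> X + Y + K"
    by argo
  then have "?L \<le> g\<^sup>2 * h\<^sup>2 + X + Y + K"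
    unfolding expand by simp
  then show ?thesis by (simp only: X_def Y_def Z_def K_def)
qed

text \<open>The inequality is stated for two functions because the induction on the dimension would not
  close for a single fourth moment: Cauchy-Schwarz on the mixed terms loses too much.\<close>

lemma hypercontractive:
  assumes "finite S"
  shows "mu p S (\<lambda>x. (fourier (\<lambda>T. (1 / 2) ^ card T * a T) S x)\<^sup>2 *
      (fourier (\<lambda>T. (1 / 2) ^ card T * b T) S x)\<^sup>2)
    \<le> (\<Sum>R\<in>Pow S. upper_weight a S R * upper_weight b S R / (sd\<^sup>2) ^ card R)"
  using assms
proof (induction S arbitrary: a b)
  case empty
  then show ?case by (simp add: mu_empty fourier_empty upper_weight_def)
next
  case (insert i S)
  let ?a = "\<lambda>T. a (insert i T)" and ?b = "\<lambda>T. b (insert i T)"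
  let ?F = "\<lambda>a. fourier (\<lambda>T. (1 / 2) ^ card T * a T) S"
  let ?U = "\<lambda>a b. \<Sum>R\<in>Pow S. upper_weight a S R * upper_weight b S R / (sd\<^sup>2) ^ card R"
  have "mu p (insert i S) (\<lambda>x. (fourier (\<lambda>T. (1 / 2) ^ card T * a T) (insert i S) x)\<^sup>2 *
      (fourier (\<lambda>T. (1 / 2) ^ card T * b T) (insert i S) x)\<^sup>2)
    \<le> mu p S (\<lambda>x. (?F a x)\<^sup>2 * (?F b x)\<^sup>2 + (?F a x)\<^sup>2 * (?F ?b x)\<^sup>2 + (?F ?a x)\<^sup>2 * (?F b x)\<^sup>2
       + (1 / sd\<^sup>2) * ((?F ?a x)\<^sup>2 * (?F ?b x)\<^sup>2))"
    unfolding mu_insert[OF insert.hyps] fourier_scale_insert[OF insert.hyps]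
    using insert.hyps(1) by (intro mu_mono two_point_inequality)
  also have "\<dots> \<le> ?U a b + ?U a ?b + ?U ?a b + (1 / sd\<^sup>2) * ?U ?a ?b"
    unfolding mu_add[OF insert.hyps(1)] mu_cmult
    by (intro add_mono mult_left_mono insert.IH) simp
  \<comment> \<open>The extra \<open>?U ?a ?b\<close> completes the product of the two sums that
    \<open>upper_weight_insert\<close> gives for sets \<open>R\<close> without \<open>i\<close>; the
    term with \<open>1 / sd\<^sup>2\<close> accounts for those with \<open>i\<close>.\<close>
  also have "\<dots> \<le> ?U a b + ?U a ?b + ?U ?a b + ?U ?a ?b + (1 / sd\<^sup>2) * ?U ?a ?b"
    by (simp add: sum_nonneg upper_weight_nonneg)
  also have "\<dots> = (\<Sum>R\<in>Pow (insert i S). upper_weight a (insert i S) R * upper_weight b (insert i S) R / (sd\<^sup>2) ^ card R)"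
  proof -
    have "card (insert i R) = Suc (card R)" if "R \<in> Pow S" for R
      using that insert.hyps by (intro card_insert_disjoint) (auto intro: finite_subset)
    then have 1: "(\<Sum>R\<in>Pow S. upper_weight a (insert i S) (insert i R) * upper_weight b (insert i S) (insert i R)
       / (sd\<^sup>2) ^ card (insert i R)) = (1 / sd\<^sup>2) * ?U ?a ?b"
      unfolding sum_distrib_left using insert.hyps
      by (intro sum.cong) (simp_all add: upper_weight_insert)
    have 2: "(\<Sum>R\<in>Pow S. upper_weight a (insert i S) R * upper_weight b (insert i S) R
       / (sd\<^sup>2) ^ card R) = ?U a b + ?U a ?b + ?U ?a b + ?U ?a ?b"
      unfolding sum.distrib[symmetric] using insert.hyps
      by (intro sum.cong) (simp_all add: upper_weight_insert add_divide_distrib algebra_simps)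
    show ?thesis
      unfolding sum_Pow_insert[OF insert.hyps] 1 2 ..
  qed
  finally show ?case .
qed

section \<open>Derivatives and restrictions\<close>

text \<open>A derivative in direction \<open>i\<close> is the difference of the restrictions to 1
  and to 0. Coordinates in \<open>J\<close> are set to 1; those in \<open>R - J\<close> are left
  random instead of being set to 0, which costs a factor 2 each since \<open>1 - p\<close> is at
  least 1/2.\<close>

lemma derivative_bound:
  assumes "finite R" "finite S" "R \<inter> S = {}"
  shows "(\<Sum>T\<in>Pow S. (a (R \<union> T))\<^sup>2) / (sd\<^sup>2) ^ card R
    \<le> 4 ^ card R * (\<Sum>J\<in>Pow R. mu p (S \<union> (R - J)) (restrict1 J (\<lambda>x. (fourier a (S \<union> R) x)\<^sup>2)))"
  using assms(1,3)
proof (induction R arbitrary: a)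
  case empty
  have "restrict1 {} f = f" for f
    by (simp add: restrict1_def fun_eq_iff)
  then show ?case
    using parseval[OF assms(2), of a a] by (simp add: power2_eq_square)
next
  case (insert i R)
  have fin: "finite (S \<union> R)" "i \<notin> S \<union> R"
    using insert assms(2) by auto
  \<comment> \<open>\<open>u\<close> and \<open>v\<close> are the coefficients after setting
    coordinate \<open>i\<close> to 1 and to 0; the induction hypothesis is applied to both.\<close>
  define u where "u T = a T + chi True * a (insert i T)" for T
  define v where "v T = a T + chi False * a (insert i T)" for T
  let ?M = "\<lambda>a R J. mu p (S \<union> (R - J)) (restrict1 J (\<lambda>x. (fourier a (S \<union> R) x)\<^sup>2))"
  let ?N = "\<lambda>a. (\<Sum>T\<in>Pow S. (a (R \<union> T))\<^sup>2) / (sd\<^sup>2) ^ card R"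
  have cong: "(a (insert i T))\<^sup>2 / sd\<^sup>2 \<le> 2 * (u T)\<^sup>2 + 2 * (v T)\<^sup>2" for T
  proof -
    have "u T - v T = (chi True - chi False) * a (insert i T)"
      by (simp add: u_def v_def algebra_simps)
    then have "(a (insert i T))\<^sup>2 / sd\<^sup>2 = (u T - v T)\<^sup>2"
      by (simp add: chi_diff power_divide)
    also have "\<dots> \<le> 2 * (u T)\<^sup>2 + 2 * (v T)\<^sup>2"
      using zero_le_power2[of "u T + v T"] by (simp add: power2_sum power2_diff)
    finally show ?thesis .
  qed
  have "(\<Sum>T\<in>Pow S. (a (insert i R \<union> T))\<^sup>2) / (sd\<^sup>2) ^ card (insert i R)
    = (\<Sum>T\<in>Pow S. (a (insert i (R \<union> T)))\<^sup>2 / sd\<^sup>2) / (sd\<^sup>2) ^ card R"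
    using insert.hyps by (simp add: sum_divide_distrib)
  also have "\<dots> \<le> (\<Sum>T\<in>Pow S. 2 * (u (R \<union> T))\<^sup>2 + 2 * (v (R \<union> T))\<^sup>2) / (sd\<^sup>2) ^ card R"
    by (intro divide_right_mono sum_mono cong) simp
  also have "\<dots> = 2 * ?N u + 2 * ?N v"
    by (simp add: sum.distrib sum_distrib_left add_divide_distrib)
  also have "\<dots> \<le> 2 * (4 ^ card R * (\<Sum>J\<in>Pow R. ?M u R J)) + 2 * (4 ^ card R * (\<Sum>J\<in>Pow R. ?M v R J))"
    using insert.prems by (intro add_mono mult_left_mono insert.IH) auto
  \<comment> \<open>Of the new factor 4, one 2 comes from squaring the difference. The other pays
    for halving the \<open>v\<close> terms and is slack on the \<open>u\<close> terms.\<close>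
  also have "\<dots> \<le> 4 ^ card (insert i R) * ((\<Sum>J\<in>Pow R. ?M v R J / 2) + (\<Sum>J\<in>Pow R. ?M u R J))"
  proof -
    have "0 \<le> (\<Sum>J\<in>Pow R. ?M u R J)"
      using fin(1) by (intro sum_nonneg mu_nonneg) (auto simp: restrict1_def)
    then show ?thesis
      using insert.hyps by (simp add: sum_divide_distrib[symmetric] algebra_simps)
  qed
  also have "\<dots> \<le> 4 ^ card (insert i R) * ((\<Sum>J\<in>Pow R. ?M a (insert i R) J) + (\<Sum>J\<in>Pow R. ?M a (insert i R) (insert i J)))"
  proof (intro mult_left_mono add_mono sum_mono)
    fix J assume "J \<in> Pow R"
    then have J: "i \<notin> J" "finite (S \<union> (R - J))" "i \<notin> S \<union> (R - J)"
      and eq: "S \<union> (insert i R - J) = insert i (S \<union> (R - J))"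
        "S \<union> (insert i R - insert i J) = S \<union> (R - J)" "S \<union> insert i R = insert i (S \<union> R)"
      using fin by auto
    have upd: "(\<lambda>j. if j \<in> J then True else (x(i := b)) j) = (\<lambda>j. if j \<in> J then True else x j)(i := b)" for x b
      using J(1) by (auto simp: fun_eq_iff)
    have "?M v R J / 2 = mu p (S \<union> (R - J)) (\<lambda>x. (1 / 2) * restrict1 J (\<lambda>x. (fourier v (S \<union> R) x)\<^sup>2) x)"
      by (simp only: mu_cmult)
    \<comment> \<open>Averaging over coordinate \<open>i\<close> gives the value 0 weight
      \<open>1 - p\<close>, at least 1/2, and the square for the value 1 is nonnegative.\<close>
    also have "\<dots> \<le> ?M a (insert i R) J"
      unfolding eq mu_insert[OF J(2,3)] restrict1_def upd fourier_insert'[OF fin] v_def[symmetric]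
    proof (rule mu_mono[OF J(2)])
      show "1 / 2 * (fourier v (S \<union> R) (\<lambda>i. if i \<in> J then True else x i))\<^sup>2
        \<le> p * (fourier (\<lambda>T. a T + chi True * a (insert i T)) (S \<union> R) (\<lambda>i. if i \<in> J then True else x i))\<^sup>2
          + (1 - p) * (fourier v (S \<union> R) (\<lambda>i. if i \<in> J then True else x i))\<^sup>2" for x
        using p_pos p_le by (intro add_increasing mult_right_mono) auto
    qed
    finally show "?M v R J / 2 \<le> ?M a (insert i R) J" .
    have upd': "(\<lambda>j. if j \<in> insert i J then True else x j) = (\<lambda>j. if j \<in> J then True else x j)(i := True)" for x
      by (auto simp: fun_eq_iff)
    show "?M u R J \<le> ?M a (insert i R) (insert i J)"
      unfolding eq restrict1_def upd' fourier_insert'[OF fin] u_def[symmetric] by simp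
  qed simp
  also have "\<dots> = 4 ^ card (insert i R) * (\<Sum>J\<in>Pow (insert i R). ?M a (insert i R) J)"
    by (simp only: sum_Pow_insert[OF insert.hyps])
  finally show ?case .
qed

text \<open>The \<open>2 ^ card R\<close> choices of \<open>J\<close> turn the factor
  \<open>4 ^ card R\<close> of \<open>derivative_bound\<close> into
  \<open>8 ^ card R\<close>.\<close>

lemma upper_weight_le:
  assumes "finite S" "R \<subseteq> S" "\<And>x. x \<in> cube S \<Longrightarrow> (fourier a S x)\<^sup>2 = f x"
    and "\<And>J. J \<subseteq> R \<Longrightarrow> mu p (S - J) (restrict1 J f) \<le> \<epsilon>"
  shows "upper_weight a S R / (sd\<^sup>2) ^ card R \<le> 8 ^ card R * \<epsilon>"
proof -
  have fin: "finite R" using assms(1,2) by (rule rev_finite_subset)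
  have S: "S - R \<union> R = S" using assms(2) by auto
  have "upper_weight a S R / (sd\<^sup>2) ^ card R \<le> 4 ^ card R *
    (\<Sum>J\<in>Pow R. mu p (S - R \<union> (R - J)) (restrict1 J (\<lambda>x. (fourier a (S - R \<union> R) x)\<^sup>2)))"
    unfolding upper_weight_def using fin assms(1) by (intro derivative_bound) auto
  also have "\<dots> \<le> 4 ^ card R * (\<Sum>J\<in>Pow R. \<epsilon>)"
  proof (intro mult_left_mono sum_mono)
    fix J assume J: "J \<in> Pow R"
    then have eq: "S - R \<union> (R - J) = S - J" using assms(2) by auto
    have "mu p (S - J) (restrict1 J (\<lambda>x. (fourier a S x)\<^sup>2)) = mu p (S - J) (restrict1 J f)"
    proof (rule mu_cong)
      fix x assume "x \<in> cube (S - J)"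
      then have "(\<lambda>i. if i \<in> J then True else x i) \<in> cube S"
        using J assms(2) by (auto simp: cube_def PiE_dflt_def)
      then show "restrict1 J (\<lambda>x. (fourier a S x)\<^sup>2) x = restrict1 J f x"
        by (simp add: restrict1_def assms(3))
    qed (use assms(1) in simp)
    then show "mu p (S - R \<union> (R - J)) (restrict1 J (\<lambda>x. (fourier a (S - R \<union> R) x)\<^sup>2)) \<le> \<epsilon>"
      unfolding eq S using assms(4) J by simp
  qed simp
  also have "\<dots> = 8 ^ card R * \<epsilon>"
    using fin by (simp add: card_Pow mult.assoc[symmetric] power_mult_distrib[symmetric])
  finally show ?thesis .
qed

section \<open>Low-degree weight of a global function\<close>

lemma fourth_moment_low_degree:
  assumes "finite S" "\<And>x. x \<in> cube S \<Longrightarrow> (fourier a S x)\<^sup>2 = f x"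
    and "\<And>J. J \<subseteq> S \<Longrightarrow> card J \<le> d \<Longrightarrow> mu p (S - J) (restrict1 J f) \<le> \<epsilon>" "0 \<le> \<epsilon>"
  shows "mu p S (\<lambda>x. (fourier (\<lambda>T. of_bool (card T \<le> d) * a T) S x) ^ 4)
    \<le> 256 ^ d * \<epsilon> * (\<Sum>T\<in>Pow S. of_bool (card T \<le> d) * (a T)\<^sup>2)"
proof -
  \<comment> \<open>Undoes the factor \<open>(1 / 2) ^ card T\<close> built into
    \<open>hypercontractive\<close>; on the surviving levels this costs at most
    \<open>2 ^ d\<close>.\<close>
  define b where "b T = 2 ^ card T * (of_bool (card T \<le> d) * a T)" for T
  have half: "(1 / 2) ^ card T * b T = of_bool (card T \<le> d) * a T" for T
    by (simp add: b_def power_divide)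
  have b_le: "(b T)\<^sup>2 \<le> 4 ^ d * (of_bool (card T \<le> d) * (a T)\<^sup>2)" for T
  proof (cases "card T \<le> d")
    case True
    have "(4::real) ^ card T = 2 ^ card T * 2 ^ card T"
      unfolding power_mult_distrib[symmetric] by simp
    then have "(b T)\<^sup>2 = 4 ^ card T * (a T)\<^sup>2"
      using True by (simp add: b_def power2_eq_square)
    also have "\<dots> \<le> 4 ^ d * (a T)\<^sup>2"
      using True by (intro mult_right_mono power_increasing) auto
    finally show ?thesis using True by simp
  qed (simp add: b_def)
  have up: "upper_weight b S R / (sd\<^sup>2) ^ card R \<le> 32 ^ d * \<epsilon>" if R: "R \<subseteq> S" for R
  proof (cases "card R \<le> d")
    case True
    have finR: "finite R" using R assms(1) by (rule finite_subset)
    have "upper_weight b S R \<le> (\<Sum>T\<in>Pow (S - R). 4 ^ d * (a (R \<union> T))\<^sup>2)"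
      unfolding upper_weight_def
      by (intro sum_mono order.trans[OF b_le] mult_left_mono) auto
    also have "\<dots> = 4 ^ d * upper_weight a S R"
      by (simp add: upper_weight_def sum_distrib_left)
    finally have "upper_weight b S R / (sd\<^sup>2) ^ card R \<le> 4 ^ d * (upper_weight a S R / (sd\<^sup>2) ^ card R)"
      by (simp add: divide_right_mono)
    also have "\<dots> \<le> 4 ^ d * (8 ^ card R * \<epsilon>)"
    proof (intro mult_left_mono upper_weight_le[where f = f, OF assms(1) R assms(2)])
      fix J assume "J \<subseteq> R"
      then show "mu p (S - J) (restrict1 J f) \<le> \<epsilon>"
        using R True finR card_mono[of R J] by (intro assms(3)) auto
    qed auto
    also have "\<dots> \<le> 4 ^ d * (8 ^ d * \<epsilon>)"
      using True assms(4) by (intro mult_left_mono mult_right_mono power_increasing) auto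
    also have "\<dots> = 32 ^ d * \<epsilon>"
      by (simp flip: power_mult_distrib mult.assoc)
    finally show ?thesis .
  next
    \<comment> \<open>Every superset of \<open>R\<close> lies above level \<open>d\<close>, where
      \<open>b\<close> vanishes.\<close>
    case False
    have "b (R \<union> T) = 0" if "T \<subseteq> S - R" for T
    proof -
      have "card R \<le> card (R \<union> T)"
        using that R assms(1) by (intro card_mono) (auto intro: finite_subset)
      then show ?thesis using False by (simp add: b_def)
    qed
    then show ?thesis using assms(4) by (simp add: upper_weight_def)
  qed
  have "mu p S (\<lambda>x. (fourier (\<lambda>T. of_bool (card T \<le> d) * a T) S x) ^ 4)
    = mu p S (\<lambda>x. (fourier (\<lambda>T. (1 / 2) ^ card T * b T) S x)\<^sup>2 * (fourier (\<lambda>T. (1 / 2) ^ card T * b T) S x)\<^sup>2)"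
    unfolding half by (simp flip: power_add)
  also have "\<dots> \<le> (\<Sum>R\<in>Pow S. upper_weight b S R / (sd\<^sup>2) ^ card R * upper_weight b S R)"
    using hypercontractive[OF assms(1), of b b] by simp
  \<comment> \<open>One of the two weight factors is bounded uniformly by globalness; the other is
    summed by double counting. The constant becomes 256 = 32 * 8, with 32 = 4 * 8 from
    \<open>up\<close> and 8 = 2 * 4 from double counting and \<open>b_le\<close>.\<close>
  also have "\<dots> \<le> (\<Sum>R\<in>Pow S. 32 ^ d * \<epsilon> * upper_weight b S R)"
    by (intro sum_mono mult_right_mono up upper_weight_nonneg) auto
  also have "\<dots> = 32 ^ d * \<epsilon> * (\<Sum>T\<in>Pow S. 2 ^ card T * (b T)\<^sup>2)"
    by (simp only: sum_distrib_left[symmetric] sum_upper_weight[OF assms(1)])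
  also have "\<dots> \<le> 32 ^ d * \<epsilon> * (\<Sum>T\<in>Pow S. 8 ^ d * (of_bool (card T \<le> d) * (a T)\<^sup>2))"
  proof (intro mult_left_mono sum_mono)
    fix T
    have "2 ^ card T * (b T)\<^sup>2 \<le> 2 ^ d * (b T)\<^sup>2"
      by (cases "card T \<le> d") (auto simp: b_def intro!: mult_right_mono power_increasing)
    also have "\<dots> \<le> 2 ^ d * (4 ^ d * (of_bool (card T \<le> d) * (a T)\<^sup>2))"
      by (intro mult_left_mono b_le) simp
    finally show "2 ^ card T * (b T)\<^sup>2 \<le> 8 ^ d * (of_bool (card T \<le> d) * (a T)\<^sup>2)"
      by (simp flip: power_mult_distrib mult.assoc)
  qed (use assms(4) in simp)
  also have "\<dots> = 256 ^ d * \<epsilon> * (\<Sum>T\<in>Pow S. of_bool (card T \<le> d) * (a T)\<^sup>2)"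
  proof -
    have "32 ^ d * \<epsilon> * (8 ^ d * w) = 256 ^ d * \<epsilon> * w" for w
      using power_mult_distrib[of 32 "8::real" d] by simp
    then show ?thesis by (simp only: sum_distrib_left[symmetric])
  qed
  finally show ?thesis .
qed

lemma level_inequality:
  assumes "finite S" "\<And>x. x \<in> cube S \<Longrightarrow> fourier a S x = f x" "f \<in> cube S \<rightarrow> {0, 1}" "0 < s"
    and glob: "\<And>J. J \<subseteq> S \<Longrightarrow> card J \<le> d \<Longrightarrow> mu p (S - J) (restrict1 J f) \<le> s ^ 3 / 256 ^ d"
  shows "(\<Sum>T\<in>Pow S. of_bool (card T \<le> d) * (a T)\<^sup>2) \<le> s * mu p S f" (is "?W \<le> _")
proof -
  define g where "g = fourier (\<lambda>T. of_bool (card T \<le> d) * a T) S"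
  have sq: "(fourier a S x)\<^sup>2 = f x" if "x \<in> cube S" for x
    using assms(2)[OF that] funcset_mem[OF assms(3) that] by auto
  have "?W = mu p S (\<lambda>x. fourier a S x * g x)"
    unfolding g_def parseval[OF assms(1)] by (simp add: power2_eq_square mult_ac)
  \<comment> \<open>Where \<open>f x = 0\<close> the left side vanishes and the right side is
    nonnegative; where \<open>f x = 1\<close> this is AM-GM, \<open>4 * t \<le> 3 + t ^ 4\<close>,
    rescaled by \<open>s\<close>.\<close>
  also have "\<dots> \<le> mu p S (\<lambda>x. 3 / 4 * s * f x + 1 / (4 * s ^ 3) * g x ^ 4)"
  proof (rule mu_mono[OF assms(1)])
    fix x assume x: "x \<in> cube S"
    have "f x = 0 \<or> f x = 1" using assms(3) x by auto
    moreover have "g x \<le> 3 / 4 * s + 1 / (4 * s ^ 3) * g x ^ 4"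
    proof -
      define t where "t = g x / s"
      have g: "g x = s * t" using assms(4) by (simp add: t_def)
      have "0 \<le> (t - 1)\<^sup>2 * ((t + 1)\<^sup>2 + 2)" by simp
      also have "\<dots> = t ^ 4 - 4 * t + 3" by algebra
      finally have "s * (4 * t) \<le> s * (3 + t ^ 4)"
        using assms(4) by (intro mult_left_mono) auto
      moreover have "1 / (4 * s ^ 3) * (s * t) ^ 4 = s * t ^ 4 / 4"
        using assms(4) by (simp add: power_mult_distrib field_simps eval_nat_numeral)
      ultimately show ?thesis unfolding g by (simp add: algebra_simps)
    qed
    moreover have "0 \<le> 1 / (4 * s ^ 3) * g x ^ 4" using assms(4) by simp
    ultimately show "fourier a S x * g x \<le> 3 / 4 * s * f x + 1 / (4 * s ^ 3) * g x ^ 4"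
      unfolding assms(2)[OF x] by auto
  qed
  also have "\<dots> = 3 / 4 * s * mu p S f + 1 / (4 * s ^ 3) * mu p S (\<lambda>x. g x ^ 4)"
    by (simp only: mu_add[OF assms(1)] mu_cmult)
  \<comment> \<open>The threshold \<open>s ^ 3 / 256 ^ d\<close> makes the fourth moment at most
    \<open>s ^ 3 * ?W\<close>, so only \<open>?W / 4\<close> appears on the right and can be
    absorbed.\<close>
  also have "\<dots> \<le> 3 / 4 * s * mu p S f + 1 / (4 * s ^ 3) * (256 ^ d * (s ^ 3 / 256 ^ d) * ?W)"
    unfolding g_def using assms(4)
    by (intro add_left_mono mult_left_mono fourth_moment_low_degree[OF assms(1) sq glob]) auto
  also have "\<dots> = 3 / 4 * s * mu p S f + ?W / 4"
    using assms(4) by simp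
  finally show ?thesis by simp
qed

section \<open>Noise sensitivity\<close>

text \<open>The squared mean is the \<open>T = {}\<close> term of a nonnegative sum, so it suffices
  to bound \<open>stab\<close> itself from above. Levels up to \<open>d\<close> are handled by
  \<open>level_inequality\<close>, higher ones by \<open>\<rho> ^ d\<close> times the total weight,
  which is the mean because \<open>f\<close> is 0/1-valued.\<close>

lemma stab_bound:
  assumes "finite S" "f \<in> cube S \<rightarrow> {0, 1}" "0 < s" "0 < \<rho>" "\<rho> < 1"
    and "\<And>J. J \<subseteq> S \<Longrightarrow> card J \<le> d \<Longrightarrow> mu p (S - J) (restrict1 J f) \<le> s ^ 3 / 256 ^ d"
  shows "\<bar>stab p S \<rho> f - (mu p S f)\<^sup>2\<bar> \<le> (s + \<rho> ^ d) * mu p S f"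
proof -
  obtain a where a: "\<And>x. x \<in> cube S \<Longrightarrow> f x = fourier a S x"
    using fourier_exists[OF assms(1), of f] by auto
  have "mu p S f = mu p S (\<lambda>x. fourier a S x * fourier a S x)"
    using assms(2) by (intro mu_cong assms(1)) (fastforce simp flip: a)
  then have weight: "mu p S f = (\<Sum>T\<in>Pow S. (a T)\<^sup>2)"
    by (simp add: parseval assms(1) power2_eq_square)
  have "mu p S f = mu p S (fourier a S)"
    by (intro mu_cong assms(1) a)
  then have mean: "mu p S f = a {}"
    by (simp add: mu_fourier assms(1))
  have stab: "stab p S \<rho> f = (\<Sum>T\<in>Pow S. \<rho> ^ card T * (a T)\<^sup>2)"
    using assms by (intro stab_fourier a) auto
  have "(\<Sum>T\<in>{{}}. \<rho> ^ card T * (a T)\<^sup>2) \<le> stab p S \<rho> f"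
    unfolding stab using assms by (intro sum_mono2) auto
  then have "(mu p S f)\<^sup>2 \<le> stab p S \<rho> f"
    by (simp add: mean)
  moreover have "stab p S \<rho> f \<le> (s + \<rho> ^ d) * mu p S f"
  proof -
    have "stab p S \<rho> f \<le> (\<Sum>T\<in>Pow S. of_bool (card T \<le> d) * (a T)\<^sup>2 + \<rho> ^ d * (a T)\<^sup>2)"
      unfolding stab
    proof (rule sum_mono)
      fix T :: "nat set"
      have "\<rho> ^ card T \<le> of_bool (card T \<le> d) + \<rho> ^ d"
      proof (cases "card T \<le> d")
        case True
        then show ?thesis using assms(4,5) by (simp add: add_increasing2 power_le_one)
      next
        case False
        then show ?thesis using assms(4,5) by (simp add: power_decreasing)
      qed
      then show "\<rho> ^ card T * (a T)\<^sup>2 \<le> of_bool (card T \<le> d) * (a T)\<^sup>2 + \<rho> ^ d * (a T)\<^sup>2"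
        by (simp only: mult_right_mono zero_le_power2 flip: distrib_right)
    qed
    also have "\<dots> = (\<Sum>T\<in>Pow S. of_bool (card T \<le> d) * (a T)\<^sup>2) + \<rho> ^ d * mu p S f"
      by (simp only: weight sum.distrib sum_distrib_left)
    also have "\<dots> \<le> s * mu p S f + \<rho> ^ d * mu p S f"
      using assms by (intro add_right_mono level_inequality) (auto simp: a[symmetric])
    finally show ?thesis by (simp add: distrib_right)
  qed
  ultimately show ?thesis
    using zero_le_power2[of "mu p S f"] by linarith
qed

end

theorem theorem3p2:
  fixes p :: "nat \<Rightarrow> real" and f :: "nat \<Rightarrow> (nat \<Rightarrow> bool) \<Rightarrow> real"
  assumes "\<And>n. 0 < p n \<and> p n \<le> 1 / 2"
    and "\<And>n. f n \<in> cube {1..n} \<rightarrow> {0, 1}"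
    and "weakly_global p f"
  shows "noise_sensitive p f"
  unfolding noise_sensitive_def
proof (intro ballI landau_o.smallI)
  fix \<rho> c :: real
  assume \<rho>: "\<rho> \<in> {0<..<1}" and c: "0 < c"
  \<comment> \<open>The error \<open>c\<close> is split evenly between the high levels,
    \<open>\<rho> ^ d\<close>, and the low ones, \<open>s\<close>.\<close>
  obtain d where d: "\<rho> ^ d < c / 2"
    using real_arch_pow_inv[of "c / 2" \<rho>] \<rho> c by auto
  define s where "s = c / 2"
  have s: "0 < s" using c by (simp add: s_def)
  \<comment> \<open>The cardinality bound is \<open>real d + 1\<close> because it must be positive
    and \<open>d\<close> may be 0.\<close>
  have "0 < s ^ 3 / 256 ^ d" "0 < real d + 1" using s by auto
  then obtain n0 where n0: "\<And>n J. n > n0 \<Longrightarrow> J \<subseteq> {1..n} \<Longrightarrow> real (card J) \<le> real d + 1 \<Longrightarrow>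
      mu (p n) ({1..n} - J) (restrict1 J (f n)) < s ^ 3 / 256 ^ d"
    using assms(3) unfolding weakly_global_def by meson
  have "norm (stab (p n) {1..n} \<rho> (f n) - (mu (p n) {1..n} (f n))\<^sup>2) \<le> c * norm (mu (p n) {1..n} (f n))"
    if "n > n0" for n
  proof -
    interpret biased_cube "p n" using assms(1) by unfold_locales auto
    have nonneg: "0 \<le> mu (p n) {1..n} (f n)"
    proof (rule mu_nonneg)
      show "0 \<le> f n x" if "x \<in> cube {1..n}" for x
        using funcset_mem[OF assms(2) that] by auto
    qed simp
    have "\<bar>stab (p n) {1..n} \<rho> (f n) - (mu (p n) {1..n} (f n))\<^sup>2\<bar> \<le> (s + \<rho> ^ d) * mu (p n) {1..n} (f n)"
    proof (rule stab_bound[OF _ assms(2) s])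
      show "mu (p n) ({1..n} - J) (restrict1 J (f n)) \<le> s ^ 3 / 256 ^ d"
        if "J \<subseteq> {1..n}" "card J \<le> d" for J
        using n0[OF \<open>n > n0\<close> that(1)] that(2) by simp
    qed (use \<rho> in auto)
    also have "\<dots> \<le> c * mu (p n) {1..n} (f n)"
      using d nonneg by (intro mult_right_mono) (auto simp: s_def)
    finally show ?thesis using nonneg by simp
  qed
  then show "\<forall>\<^sub>F n in sequentially. norm (stab (p n) {1..n} \<rho> (f n) - (mu (p n) {1..n} (f n))\<^sup>2)
      \<le> c * norm (mu (p n) {1..n} (f n))"
    by (rule eventually_mono[OF eventually_gt_at_top[of n0]])
qed

end
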